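(* Let $a,b\in\mathbb{R}$ with $b\neq 0$ and $a<b<-a$. Let $g\in AP(\mathbb{R})$. Then the equation $$\ddot x(t)+a x(t)+b x(-t)=g(t),\qquad t\in\mathbb{R},$$ has a unique almost periodic solution $x(t)$, and $\mathrm{mod}(x)=\mathrm{mod}(g)$. Furthermore, if $g$ is periodic, with period $\omega$, then the equation has a unique harmonic (that is, $\omega$-periodic) solution.
   Context: A solution is a twice differentiable function $x:\mathbb{R}\to\mathbb{C}$ satisfying the equation for all $t\in\mathbb{R}$. A (continuous) function $f:\mathbb{R}\to\mathbb{C}$ is almost periodic if for every $\epsilon>0$ the set $\mathbf{T}(f,\epsilon)=\{\tau\in\mathbb{R}: |f(t+\tau)-f(t)|<\epsilon \ \forall t\in\mathbb{R}\}$ is relatively dense in $\mathbb{R}$; $AP(\mathbb{R})$ denotes the set of all such functions. $\mathrm{Freq}(f)$ denotes the frequency set of $f$, i.e. the set of $\lambda\in\mathbb{R}$ with $\lim_{T\to\infty}\frac1{2T}\int_{-T}^{T}f(t)e^{-i\lambda t}dt\neq 0$, and $\mathrm{mod}(f)$ is the frequency module of $f$, i.e. the additive subgroup of $\mathbb{R}$ generated by $\mathrm{Freq}(f)$. *)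

theory Defs
  imports
    "HOL-Analysis.Analysis"
    "HOL-Library.Periodic_Fun"
    "HOL-Computational_Algebra.Group_Closure"
begin

definition relatively_dense :: "real set \<Rightarrow> bool" where
  "relatively_dense S \<longleftrightarrow> (\<exists>L>0. \<forall>s. S \<inter> {s..s + L} \<noteq> {})"

definition translation_set :: "(real \<Rightarrow> complex) \<Rightarrow> real \<Rightarrow> real set" where
  "translation_set f \<epsilon> = {\<tau>. \<forall>t. cmod (f (t + \<tau>) - f t) < \<epsilon>}"

definition AP :: "(real \<Rightarrow> complex) set" where
  "AP = {f. continuous_on UNIV f \<and> (\<forall>\<epsilon>>0. relatively_dense (translation_set f \<epsilon>))}"

definition Freq :: "(real \<Rightarrow> complex) \<Rightarrow> real set" where
  "Freq f = {l. \<exists>c. c \<noteq> 0 \<and>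
     ((\<lambda>T. complex_of_real (1 / (2 * T)) *
        integral {-T..T} (\<lambda>t. f t * exp (- (\<i> * complex_of_real (l * t))))) \<longlongrightarrow> c) at_top}"

definition freq_module :: "(real \<Rightarrow> complex) \<Rightarrow> real set" where
  "freq_module f = group_closure (Freq f)"

definition reflection_solution ::
    "real \<Rightarrow> real \<Rightarrow> (real \<Rightarrow> complex) \<Rightarrow> (real \<Rightarrow> complex) \<Rightarrow> bool" where
  "reflection_solution a b g x \<longleftrightarrow> (\<exists>x' x''. \<forall>t.
     (x has_vector_derivative x' t) (at t) \<and>
     (x' has_vector_derivative x'' t) (at t) \<and>
     x'' t + complex_of_real a * x t + complex_of_real b * x (-t) = g t)"

end

theory Submission
  imports Defs
begin

text \<open>
  The reflection \<open>t \<mapsto> -t\<close> is diagonalised by passing to even and odd parts. Writing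
  \<open>x = p + q\<close> with \<open>p\<close> even and \<open>q\<close> odd, the equation splits into the two scalar equations
  \<open>p'' = \<alpha>\<^sup>2 p + g\<^sub>e\<close> and \<open>q'' = \<beta>\<^sup>2 q + g\<^sub>o\<close>, where
  \<open>\<alpha>\<^sup>2 = -(a + b)\<close> and \<open>\<beta>\<^sup>2 = b - a\<close>; the condition \<open>a < b < -a\<close> says precisely that both are positive.

  A scalar equation \<open>y'' = c\<^sup>2 y + f\<close> with \<open>c > 0\<close> is hyperbolic: its nonzero homogeneous solutions are
  unbounded, so a bounded continuous \<open>f\<close> gives exactly one bounded \<open>y\<close>, and \<open>\<bar>y\<bar> \<le> sup \<bar>f\<bar> / c\<^sup>2\<close>
  (\<open>bounded_solution_exists\<close>, \<open>bounded_solution_unique\<close>, \<open>bounded_solution_estimate\<close>). This estimate,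
  applied to the difference \<open>y(t + \<tau>) - y(t)\<close>, is what makes the theorem work: every
  \<open>\<epsilon>\<close>-translation number of \<open>g\<close> is a \<open>C \<epsilon>\<close>-translation number of \<open>x\<close>. Hence \<open>x\<close> is almost periodic
  if \<open>g\<close> is, and (taking \<open>\<epsilon> = 0\<close>) \<open>\<omega>\<close>-periodic if \<open>g\<close> is. Uniqueness follows in
  both classes because almost periodic functions and continuous periodic functions are bounded.

  For the frequency modules, an integration by parts relates the Fourier-Bohr coefficients by
  \<open>g\<^sub>\<lambda> = (a - \<lambda>\<^sup>2) x\<^sub>\<lambda> + b x\<^sub>-\<^sub>\<lambda>\<close>. Together with the same identity at \<open>-\<lambda>\<close> this is a linear system
  of determinant \<open>(a - \<lambda>\<^sup>2)\<^sup>2 - b\<^sup>2 > 0\<close>. So the pairs of coefficients at \<open>\<plusminus>\<lambda>\<close> vanish simultaneously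
  for \<open>x\<close> and \<open>g\<close>: the two frequency sets agree up to sign, and a subgroup cannot
  see the sign. The argument needs every Fourier-Bohr coefficient of an almost periodic function to
  exist, since a frequency could otherwise be missing because a limit diverges; this is
  the mean value theorem of Bohr (\<open>AP_mean_almost_constant\<close>), applied to \<open>f\<close> times a character
  (\<open>AP_mult_character\<close>).
\<close>

section \<open>Bounded solutions of a scalar hyperbolic equation\<close>

text \<open>
  The solution is \<open>u(t) = \<integral>\<^sub>0\<^sup>\<infinity> e\<^bsup>-cs\<^esup> f(t + s) ds\<close>, in which the bound is evident. It is written below as
  \<open>e\<^bsup>ct\<^esup>\<close> times \<open>\<integral>\<^sub>t\<^sup>\<infinity> e\<^bsup>-cr\<^esup> f(r) dr\<close>, so that \<open>t\<close> enters the integral only as a limit of integration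
  and differentiability follows from continuity of \<open>f\<close> alone.
\<close>
lemma first_order_bounded_solution:
  fixes f :: "real \<Rightarrow> complex"
  assumes cont: "continuous_on UNIV f" and bd: "\<And>t. cmod (f t) \<le> B" and c: "c > 0"
  obtains u where
    "\<And>t. (u has_vector_derivative (of_real c * u t - f t)) (at t)"
    "\<And>t. cmod (u t) \<le> B / c"
proof -
  define h where "h = (\<lambda>r. of_real (exp (- c * r)) * f r)"
  define G where "G = (\<lambda>t. integral {t..} h)"
  define u where "u = (\<lambda>t. of_real (exp (c * t)) * G t)"
  have conth: "continuous_on S h" for S
    unfolding h_def by (intro continuous_intros continuous_on_subset[OF cont]) auto
  have hbd: "norm (h r) \<le> B * exp (- c * r)" for r
    using bd[of r] by (simp add: h_def norm_mult mult.commute)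
  have dom: "((\<lambda>r. B * exp (- c * r)) has_integral B * (exp (- c * t) / c)) {t..}" for t
    using has_integral_exp_minus_to_infinity[OF c, of t] by (rule has_integral_mult_right)
  have meas: "h \<in> borel_measurable (lebesgue_on {t..})" for t
    by (intro continuous_imp_measurable_on_sets_lebesgue conth) auto
  have int: "h integrable_on {t..}" for t
    by (rule measurable_bounded_by_integrable_imp_integrable[OF meas _ hbd])
       (use dom[of t] in auto)
  have Gbd: "norm (G t) \<le> B * (exp (- c * t) / c)" for t
    unfolding G_def by (rule integral_norm_bound_integral'[OF hbd meas _ dom]) auto
  have Gsplit: "G s = G a - integral {a..s} h" if "a \<le> s" for a s
  proof -
    have "(h has_integral (integral {a..s} h + G s)) ({a..s} \<union> {s..})"
      unfolding G_def
      by (intro has_integral_Un integrable_integral int integrable_continuous_real conth)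
         (auto intro: negligible_subset[of "{s}"])
    moreover have "{a..s} \<union> {s..} = {a..}" using that by auto
    ultimately have "G a = integral {a..s} h + G s"
      unfolding G_def by (simp add: integral_unique)
    thus ?thesis by simp
  qed
  have dG: "(G has_vector_derivative - h t) (at t)" for t
  proof -
    \<comment> \<open>Near \<open>t\<close> the tail integral is a constant minus an integral from the base point \<open>t - 1\<close>.\<close>
    have "((\<lambda>s. integral {t - 1..s} h) has_vector_derivative h t) (at t within {t - 1..t + 1})"
      by (rule integral_has_vector_derivative[OF conth]) auto
    hence "((\<lambda>s. integral {t - 1..s} h) has_vector_derivative h t) (at t)"
      by (simp add: at_within_Icc_at)
    hence "((\<lambda>s. G (t - 1) - integral {t - 1..s} h) has_vector_derivative (0 - h t)) (at t)"
      by (intro derivative_intros)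
    hence "((\<lambda>s. G (t - 1) - integral {t - 1..s} h) has_vector_derivative - h t) (at t)"
      by simp
    thus ?thesis
      by (rule has_vector_derivative_transform_within_open[where S = "{t - 1<..}"])
         (auto intro!: Gsplit[symmetric])
  qed
  have "(u has_vector_derivative (of_real c * u t - f t)) (at t)" for t
  proof -
    have "((\<lambda>t. of_real (exp (c * t))) has_vector_derivative complex_of_real (c * exp (c * t))) (at t)"
      by (intro has_vector_derivative_of_real) (auto intro!: derivative_eq_intros)
    from has_vector_derivative_mult[OF this dG]
    have "(u has_vector_derivative
        (of_real (exp (c * t)) * - h t + of_real (c * exp (c * t)) * G t)) (at t)"
      unfolding u_def .
    moreover have "of_real (exp (c * t)) * h t = f t"
      by (simp add: h_def mult.assoc[symmetric] flip: of_real_mult exp_add)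
    ultimately show ?thesis by (simp add: u_def mult_ac)
  qed
  moreover have "cmod (u t) \<le> B / c" for t
  proof -
    have "cmod (u t) \<le> exp (c * t) * (B * (exp (- c * t) / c))"
      using mult_left_mono[OF Gbd[of t], of "exp (c * t)"] by (simp add: u_def norm_mult)
    also have "\<dots> = B / c" by (simp add: exp_minus field_simps)
    finally show ?thesis .
  qed
  ultimately show ?thesis using that by blast
qed

lemma has_vector_derivative_compose_uminus:
  assumes "\<And>t. (f has_vector_derivative f' t) (at t)"
  shows "((\<lambda>t. f (- t)) has_vector_derivative - f' (- t)) (at (t :: real))"
proof -
  have "(uminus has_vector_derivative (- 1 :: real)) (at t)"
    by (auto intro!: derivative_eq_intros)
  from vector_diff_chain_at[OF this assms] show ?thesis by (simp add: o_def)
qed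

lemma has_vector_derivative_shift:
  assumes "\<And>t. (f has_vector_derivative f' t) (at t)"
  shows "((\<lambda>t. f (t + \<tau>)) has_vector_derivative f' (t + \<tau>)) (at (t :: real))"
proof -
  have "((\<lambda>t. t + \<tau>) has_vector_derivative (1 :: real)) (at t)"
    by (auto intro!: derivative_eq_intros)
  from vector_diff_chain_at[OF this assms] show ?thesis by (simp add: o_def)
qed

text \<open>
  The operator \<open>D\<^sup>2 - c\<^sup>2\<close> factors as \<open>(D - c)(D + c)\<close>. With bounded \<open>u\<close>, \<open>v\<close> such that \<open>u' = c u - f\<close> and
  \<open>v' = -c v + f\<close>, the function \<open>-(u + v) / (2c)\<close> is a solution; this is the convolution of \<open>f\<close> with the
  Green kernel \<open>-e\<^bsup>-c\<bar>s\<bar>\<^esup> / (2c)\<close>. Reversing time turns the equation of \<open>v\<close> into that of \<open>u\<close>. The derivative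
  is bounded as well, which later kills the boundary terms of an integration by parts.
\<close>
lemma bounded_solution_exists:
  fixes f :: "real \<Rightarrow> complex"
  assumes cont: "continuous_on UNIV f" and bd: "\<And>t. cmod (f t) \<le> B" and c: "c > 0"
  obtains y y' where
    "\<And>t. (y has_vector_derivative y' t) (at t)"
    "\<And>t. (y' has_vector_derivative (of_real (c\<^sup>2) * y t + f t)) (at t)"
    "\<And>t. cmod (y t) \<le> B / c\<^sup>2" "\<And>t. cmod (y' t) \<le> B / c"
proof -
  obtain u where u: "\<And>t. (u has_vector_derivative (of_real c * u t - f t)) (at t)"
    and ub: "\<And>t. cmod (u t) \<le> B / c"
    using first_order_bounded_solution[OF cont bd c] by blast
  have cont': "continuous_on UNIV (\<lambda>t. f (- t))"
    by (intro continuous_on_compose2[OF cont] continuous_intros) auto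
  obtain w where w: "\<And>t. (w has_vector_derivative (of_real c * w t - f (- t))) (at t)"
    and wb: "\<And>t. cmod (w t) \<le> B / c"
    using first_order_bounded_solution[OF cont' bd c] by blast
  define v where "v = (\<lambda>t. w (- t))"
  have v: "(v has_vector_derivative (f t - of_real c * v t)) (at t)" for t
    using has_vector_derivative_compose_uminus[OF w, of t] by (simp add: v_def)
  have vb: "cmod (v t) \<le> B / c" for t using wb by (simp add: v_def)
  define y where "y = (\<lambda>t. - (u t + v t) / of_real (2 * c))"
  define y' where "y' = (\<lambda>t. (v t - u t) / 2)"
  have "(y has_vector_derivative y' t) (at t)" for t
    unfolding y_def y'_def
    by (rule derivative_eq_intros u v refl)+ (use c in \<open>simp add: field_simps\<close>)
  moreover have "(y' has_vector_derivative (of_real (c\<^sup>2) * y t + f t)) (at t)" for t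
    unfolding y_def y'_def
    by (rule derivative_eq_intros u v refl)+ (use c in \<open>simp add: field_simps power2_eq_square\<close>)
  moreover have "cmod (y t) \<le> B / c\<^sup>2" for t
  proof -
    have "cmod (u t + v t) \<le> B / c + B / c" by (intro norm_triangle_mono ub vb)
    hence "cmod (u t + v t) / (2 * c) \<le> (B / c + B / c) / (2 * c)"
      using c by (intro divide_right_mono) auto
    also have "\<dots> = B / c\<^sup>2" using c by (simp add: field_simps power2_eq_square)
    finally show ?thesis using c by (simp add: y_def norm_divide norm_mult norm_minus_commute del: minus_add_distrib)
  qed
  moreover have "cmod (y' t) \<le> B / c" for t
  proof -
    have "cmod (v t - u t) \<le> B / c + B / c"
      using norm_triangle_ineq4[of "v t" "u t"] ub[of t] vb[of t] by linarith
    thus ?thesis by (simp add: y'_def norm_divide mult.commute)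
  qed
  ultimately show ?thesis using that by blast
qed

lemma exponential_ODE:
  fixes v :: "real \<Rightarrow> complex"
  assumes "\<And>t. (v has_vector_derivative of_real k * v t) (at t)"
  shows "v t = of_real (exp (k * t)) * v 0"
proof -
  define w where "w = (\<lambda>t. of_real (exp (- k * t)) * v t)"
  have "(w has_vector_derivative 0) (at t)" for t
  proof -
    have "((\<lambda>t. of_real (exp (- k * t))) has_vector_derivative complex_of_real (- k * exp (- k * t))) (at t)"
      by (intro has_vector_derivative_of_real) (auto intro!: derivative_eq_intros)
    from has_vector_derivative_mult[OF this assms]
    show ?thesis unfolding w_def by (simp add: algebra_simps)
  qed
  hence "(w has_derivative (\<lambda>h. 0)) (at t within UNIV)" for t
    by (simp add: has_vector_derivative_def)
  then obtain d where "w t = d" for t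
    using has_derivative_zero_constant[of UNIV w] by auto
  hence "w t = w 0" by metis
  hence "of_real (exp (k * t)) * w t = of_real (exp (k * t)) * v 0" by (simp add: w_def)
  moreover have "of_real (exp (k * t)) * w t = v t"
    by (simp add: w_def mult.assoc[symmetric] flip: of_real_mult exp_add)
  ultimately show ?thesis by simp
qed

text \<open>
  The combinations \<open>y' + c y\<close> and \<open>y' - c y\<close> are multiples of \<open>e\<^bsup>ct\<^esup>\<close> and \<open>e\<^bsup>-ct\<^esup>\<close>. Boundedness of \<open>y\<close> as
  \<open>t \<rightarrow> \<infinity>\<close> annihilates the first, and then as \<open>t \<rightarrow> -\<infinity>\<close> the second.
\<close>
lemma bounded_solution_unique:
  fixes y :: "real \<Rightarrow> complex"
  assumes c: "c > 0"
    and d1: "\<And>t. (y has_vector_derivative y' t) (at t)"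
    and d2: "\<And>t. (y' has_vector_derivative (of_real (c\<^sup>2) * y t)) (at t)"
    and bd: "\<And>t. cmod (y t) \<le> M"
  shows "y t = 0"
proof -
  define v where "v = (\<lambda>t. y' t + of_real c * y t)"
  define u where "u = (\<lambda>t. y' t - of_real c * y t)"
  have v: "v t = of_real (exp (c * t)) * v 0" for t
    by (rule exponential_ODE, unfold v_def, (rule derivative_eq_intros d1 d2 refl)+)
       (simp add: algebra_simps power2_eq_square)
  have u: "u t = of_real (exp (- c * t)) * u 0" for t
    by (rule exponential_ODE, unfold u_def, (rule derivative_eq_intros d1 d2 refl)+)
       (simp add: algebra_simps power2_eq_square)
  have y: "2 * of_real c * y t = of_real (exp (c * t)) * v 0 - of_real (exp (- c * t)) * u 0" for t
  proof -
    have "2 * of_real c * y t = v t - u t" by (simp add: u_def v_def)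
    thus ?thesis by (simp only: u[of t] v[of t])
  qed
  have escape: "p = 0" if p: "\<And>t. t \<ge> 0 \<Longrightarrow> exp (c * t) * cmod p \<le> K" for p K
  proof (rule ccontr)
    assume "p \<noteq> 0"
    hence "cmod p > 0" by simp
    have "K \<ge> 0" using p[of 0] norm_ge_zero[of p] by (simp del: norm_ge_zero)
    \<comment> \<open>At this time already the lower bound \<open>1 + c t\<close> for the exponential exceeds \<open>K\<close> after scaling.\<close>
    define t where "t = K / (c * cmod p)"
    have "t \<ge> 0" using \<open>K \<ge> 0\<close> c by (simp add: t_def)
    have "K + cmod p = (1 + c * t) * cmod p"
      using c \<open>cmod p > 0\<close> by (simp add: t_def field_simps)
    also have "\<dots> \<le> exp (c * t) * cmod p"
      by (intro mult_right_mono exp_ge_add_one_self) auto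
    also have "\<dots> \<le> K" using p[OF \<open>t \<ge> 0\<close>] .
    finally show False using \<open>cmod p > 0\<close> by simp
  qed
  have nb: "cmod (2 * of_real c * y t) \<le> 2 * c * M" for t
    using bd[of t] c by (simp add: norm_mult)
  have "v 0 = 0"
  proof (rule escape)
    fix t :: real assume "t \<ge> 0"
    have "exp (c * t) * cmod (v 0) = cmod (of_real (exp (c * t)) * v 0)" by (simp add: norm_mult)
    also have "of_real (exp (c * t)) * v 0 = 2 * of_real c * y t + of_real (exp (- c * t)) * u 0"
      using y[of t] by simp
    also have "cmod \<dots> \<le> 2 * c * M + cmod (of_real (exp (- c * t)) * u 0)"
      by (intro norm_triangle_mono nb) simp
    also have "cmod (of_real (exp (- c * t)) * u 0) = exp (- c * t) * cmod (u 0)"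
      by (simp add: norm_mult)
    also have "\<dots> \<le> 1 * cmod (u 0)"
      using c \<open>t \<ge> 0\<close> by (intro mult_right_mono) auto
    finally show "exp (c * t) * cmod (v 0) \<le> 2 * c * M + cmod (u 0)" by simp
  qed
  moreover have "u 0 = 0"
  proof (rule escape)
    fix t :: real assume "t \<ge> 0"
    have "exp (c * t) * cmod (u 0) = cmod (of_real (exp (- c * (- t))) * u 0)"
      by (simp add: norm_mult)
    also have "\<dots> = cmod (2 * of_real c * y (- t))"
      using y[of "- t"] \<open>v 0 = 0\<close> by simp
    also have "\<dots> \<le> 2 * c * M" by (rule nb)
    finally show "exp (c * t) * cmod (u 0) \<le> 2 * c * M" .
  qed
  ultimately show ?thesis using y[of t] c by simp
qed

text \<open>By uniqueness, any bounded solution inherits the bound of the one built above.\<close>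
lemma bounded_solution_estimate:
  fixes y :: "real \<Rightarrow> complex"
  assumes c: "c > 0" and cont: "continuous_on UNIV f" and fb: "\<And>t. cmod (f t) \<le> B"
    and d1: "\<And>t. (y has_vector_derivative y' t) (at t)"
    and d2: "\<And>t. (y' has_vector_derivative (of_real (c\<^sup>2) * y t + f t)) (at t)"
    and bd: "\<And>t. cmod (y t) \<le> M"
  shows "cmod (y t) \<le> B / c\<^sup>2"
proof -
  obtain z z' where z1: "\<And>t. (z has_vector_derivative z' t) (at t)"
    and z2: "\<And>t. (z' has_vector_derivative (of_real (c\<^sup>2) * z t + f t)) (at t)"
    and zb: "\<And>t. cmod (z t) \<le> B / c\<^sup>2"
    by (rule bounded_solution_exists[OF cont fb c], rule that)
  have "(\<lambda>t. y t - z t) t = 0"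
  proof (rule bounded_solution_unique[OF c])
    show "((\<lambda>t. y t - z t) has_vector_derivative (y' t - z' t)) (at t)" for t
      by (intro derivative_intros d1 z1)
    show "((\<lambda>t. y' t - z' t) has_vector_derivative of_real (c\<^sup>2) * (y t - z t)) (at t)" for t
      by (rule derivative_eq_intros d2 z2 refl)+ (simp add: algebra_simps)
    show "cmod (y t - z t) \<le> M + B / c\<^sup>2" for t
      using norm_triangle_ineq4[of "y t" "z t"] bd[of t] zb[of t] by linarith
  qed
  thus ?thesis using zb[of t] by simp
qed

text \<open>
  The difference \<open>y(t + \<tau>) - y(t)\<close> is a bounded solution with right-hand side
  \<open>f(t + \<tau>) - f(t)\<close>, so the a priori estimate passes translation numbers from \<open>f\<close> to \<open>y\<close>.
\<close>
lemma bounded_solution_translate: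
  fixes y :: "real \<Rightarrow> complex"
  assumes c: "c > 0" and cont: "continuous_on UNIV f"
    and d1: "\<And>t. (y has_vector_derivative y' t) (at t)"
    and d2: "\<And>t. (y' has_vector_derivative (of_real (c\<^sup>2) * y t + f t)) (at t)"
    and bd: "\<And>t. cmod (y t) \<le> M"
    and close: "\<And>t. cmod (f (t + \<tau>) - f t) \<le> e"
  shows "cmod (y (t + \<tau>) - y t) \<le> e / c\<^sup>2"
proof (rule bounded_solution_estimate[OF c _ close])
  show "continuous_on UNIV (\<lambda>t. f (t + \<tau>) - f t)"
    by (intro continuous_intros cont continuous_on_compose2[OF cont]) auto
  show "((\<lambda>t. y (t + \<tau>) - y t) has_vector_derivative (y' (t + \<tau>) - y' t)) (at t)" for t
    by (intro derivative_intros has_vector_derivative_shift d1)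
  show "((\<lambda>t. y' (t + \<tau>) - y' t) has_vector_derivative
      of_real (c\<^sup>2) * (y (t + \<tau>) - y t) + (f (t + \<tau>) - f t)) (at t)" for t
    by (rule derivative_eq_intros has_vector_derivative_shift d2 refl)+ (simp add: algebra_simps)
  show "cmod (y (t + \<tau>) - y t) \<le> M + M" for t
    using norm_triangle_ineq4[of "y (t + \<tau>)" "y t"] bd[of t] bd[of "t + \<tau>"] by linarith
qed

text \<open>
  The factor \<open>s\<close> is \<open>1\<close> for even and \<open>-1\<close> for odd functions; the equation is invariant under \<open>t \<mapsto> -t\<close>,
  so uniqueness makes the solution inherit the parity of the right-hand side.
\<close>
lemma bounded_solution_parity:
  fixes y :: "real \<Rightarrow> complex"
  assumes c: "c > 0"
    and d1: "\<And>t. (y has_vector_derivative y' t) (at t)"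
    and d2: "\<And>t. (y' has_vector_derivative (of_real (c\<^sup>2) * y t + f t)) (at t)"
    and bd: "\<And>t. cmod (y t) \<le> M"
    and parity: "\<And>t. f (- t) = s * f t"
  shows "y (- t) = s * y t"
proof -
  have "(\<lambda>t. y (- t) - s * y t) t = 0"
  proof (rule bounded_solution_unique[OF c])
    show "((\<lambda>t. y (- t) - s * y t) has_vector_derivative - y' (- t) - s * y' t) (at t)" for t
      by (intro derivative_intros has_vector_derivative_compose_uminus d1)
    show "((\<lambda>t. - y' (- t) - s * y' t) has_vector_derivative
        of_real (c\<^sup>2) * (y (- t) - s * y t)) (at t)" for t
      by (rule derivative_eq_intros has_vector_derivative_compose_uminus d2 refl)+
         (simp add: algebra_simps parity)
    show "cmod (y (- t) - s * y t) \<le> M + cmod s * M" for t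
      using norm_triangle_ineq4[of "y (- t)" "s * y t"] bd[of "- t"]
        mult_left_mono[OF bd[of t], of "cmod s"] by (simp add: norm_mult)
  qed
  thus ?thesis by simp
qed

section \<open>Almost periodic functions and their mean values\<close>

lemma AP_continuous: "f \<in> AP \<Longrightarrow> continuous_on S f"
  by (auto simp: AP_def intro: continuous_on_subset)

lemma AP_translation_number:
  assumes "f \<in> AP" and "\<epsilon> > 0"
  obtains L where "L > 0"
    "\<And>s. \<exists>\<tau>\<in>{s..s + L}. \<forall>t. cmod (f (t + \<tau>) - f t) < \<epsilon>"
  using assms by (fastforce simp: AP_def relatively_dense_def translation_set_def)

text \<open>A translation number for \<open>\<epsilon> = 1\<close> carries any point into the compact interval \<open>[0, L]\<close>.\<close>
lemma AP_bounded:
  assumes "f \<in> AP"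
  obtains B where "B > 0" "\<And>t. cmod (f t) \<le> B"
proof -
  obtain L where L: "L > 0" "\<And>s. \<exists>\<tau>\<in>{s..s + L}. \<forall>t. cmod (f (t + \<tau>) - f t) < 1"
    using AP_translation_number[OF assms, of 1] by auto
  have "bounded (f ` {0..L})"
    by (intro compact_imp_bounded compact_continuous_image AP_continuous assms compact_Icc)
  then obtain M where M: "M > 0" "\<And>t. t \<in> {0..L} \<Longrightarrow> cmod (f t) \<le> M"
    by (auto simp: bounded_pos)
  have "cmod (f t) \<le> M + 1" for t
  proof -
    obtain \<tau> where \<tau>: "\<tau> \<in> {- t..- t + L}" "\<forall>t. cmod (f (t + \<tau>) - f t) < 1"
      using L(2) by blast
    have "cmod (f t) \<le> cmod (f (t + \<tau>)) + cmod (f (t + \<tau>) - f t)"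
      using norm_triangle_sub[of "f t" "f (t + \<tau>)"] by (simp add: norm_minus_commute)
    moreover have "cmod (f (t + \<tau>)) \<le> M" using \<tau>(1) by (intro M(2)) auto
    ultimately show ?thesis using \<tau>(2)[rule_format, of t] by linarith
  qed
  thus ?thesis using that[of "M + 1"] M(1) by simp
qed

definition character :: "real \<Rightarrow> real \<Rightarrow> complex" where
  "character l t = exp (- (\<i> * complex_of_real (l * t)))"

lemma norm_character [simp]: "cmod (character l t) = 1"
  by (simp add: character_def)

lemma character_add: "character l (s + t) = character l s * character l t"
  by (simp add: character_def ring_distribs flip: exp_add)

lemma character_uminus: "character l (- t) = character (- l) t"
  by (simp add: character_def)

lemma continuous_on_character [continuous_intros]: "continuous_on S (character l)"
  unfolding character_def by (intro continuous_intros)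

text \<open>
  What is needed are common translation numbers of \<open>f\<close> and the character. Choose a translation
  number \<open>\<tau> s\<close> of \<open>f\<close> in every interval \<open>[s, s + L]\<close>. The values of the character at these points lie on the
  circle, so by compactness finitely many of them are \<open>\<delta>\<close>-dense among all. Subtracting from
  \<open>\<tau> s\<close> the representative \<open>\<tau> k\<close> whose character value is close leaves a translation number of \<open>f\<close> at
  which the character is close to \<open>1\<close>. Only finitely many \<open>\<tau> k\<close> are used, so
  they shift the interval by a bounded amount and relative density survives.
\<close>
lemma AP_mult_character:
  assumes f: "f \<in> AP"
  shows "(\<lambda>t. f t * character l t) \<in> AP"
  unfolding AP_def
proof (intro CollectI conjI allI impI)
  show "continuous_on UNIV (\<lambda>t. f t * character l t)"
    by (intro continuous_intros AP_continuous[OF f])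
  fix \<epsilon> :: real assume \<epsilon>: "\<epsilon> > 0"
  obtain B where B: "B > 0" "\<And>t. cmod (f t) \<le> B" using AP_bounded[OF f] by blast
  define \<delta> where "\<delta> = \<epsilon> / (2 * B)"
  have \<delta>: "\<delta> > 0" using \<epsilon> B by (simp add: \<delta>_def)
  obtain L where L: "L > 0" "\<And>s. \<exists>\<tau>\<in>{s..s + L}. \<forall>t. cmod (f (t + \<tau>) - f t) < \<epsilon> / 4"
    using AP_translation_number[OF f, of "\<epsilon> / 4"] \<epsilon> by auto
  then obtain \<tau> where \<tau>: "\<And>s. \<tau> s \<in> {s..s + L}"
    and \<tau>f: "\<And>s t. cmod (f (t + \<tau> s) - f t) < \<epsilon> / 4"
    by metis
  define E where "E = range (\<lambda>s. character l (\<tau> s))"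
  have "bounded E" by (rule boundedI[of _ 1]) (auto simp: E_def)
  hence "compact (closure E)" by simp
  moreover have "closure E \<subseteq> (\<Union>s\<in>UNIV. ball (character l (\<tau> s)) \<delta>)"
  proof
    fix z assume "z \<in> closure E"
    then obtain w where "w \<in> E" "dist w z < \<delta>" using \<delta> by (auto simp: closure_approachable)
    thus "z \<in> (\<Union>s\<in>UNIV. ball (character l (\<tau> s)) \<delta>)" by (auto simp: E_def)
  qed
  ultimately obtain K where K: "finite K" "closure E \<subseteq> (\<Union>s\<in>K. ball (character l (\<tau> s)) \<delta>)"
    using compactE_image[of "closure E" UNIV "\<lambda>s. ball (character l (\<tau> s)) \<delta>"] by auto
  have "bounded (\<tau> ` K)" using K(1) by (intro finite_imp_bounded) auto
  then obtain M where M: "M > 0" "\<And>s. s \<in> K \<Longrightarrow> \<bar>\<tau> s\<bar> \<le> M" by (auto simp: bounded_pos)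
  have "\<exists>\<sigma>\<in>{s..s + (L + 2 * M)}. \<forall>t.
      cmod (f (t + \<sigma>) * character l (t + \<sigma>) - f t * character l t) < \<epsilon>" for s
  proof -
    have "character l (\<tau> (s + M)) \<in> closure E"
      using closure_subset[of E] by (auto simp: E_def)
    then obtain k where k: "k \<in> K" "dist (character l (\<tau> k)) (character l (\<tau> (s + M))) < \<delta>"
      using K(2) by auto
    define \<sigma> where "\<sigma> = \<tau> (s + M) - \<tau> k"
    have "\<sigma> \<in> {s..s + (L + 2 * M)}"
      using \<tau>[of "s + M"] M(2)[OF k(1)] by (auto simp: \<sigma>_def abs_le_iff)
    moreover have "cmod (f (t + \<sigma>) * character l (t + \<sigma>) - f t * character l t) < \<epsilon>" for t
    proof -
      have "f (t + \<sigma>) - f t = (f (t - \<tau> k + \<tau> (s + M)) - f (t - \<tau> k)) - (f (t - \<tau> k + \<tau> k) - f (t - \<tau> k))"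
        by (simp add: \<sigma>_def algebra_simps)
      also have "cmod \<dots> \<le> cmod (f (t - \<tau> k + \<tau> (s + M)) - f (t - \<tau> k)) +
          cmod (f (t - \<tau> k + \<tau> k) - f (t - \<tau> k))"
        by (rule norm_triangle_ineq4)
      also have "\<dots> < \<epsilon> / 4 + \<epsilon> / 4" by (intro add_strict_mono \<tau>f)
      finally have 1: "cmod (f (t + \<sigma>) - f t) < \<epsilon> / 2" by simp
      have "character l (t + \<sigma>) - character l t = character l (t - \<tau> k) *
          (character l (\<tau> (s + M)) - character l (\<tau> k))"
        by (simp add: \<sigma>_def right_diff_distrib flip: character_add) (simp add: algebra_simps)
      hence 2: "cmod (character l (t + \<sigma>) - character l t) < \<delta>"
        using k(2) by (simp add: norm_mult dist_norm norm_minus_commute)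
      have "f (t + \<sigma>) * character l (t + \<sigma>) - f t * character l t =
          (f (t + \<sigma>) - f t) * character l (t + \<sigma>) + f t * (character l (t + \<sigma>) - character l t)"
        by (simp add: algebra_simps)
      also have "cmod \<dots> \<le> cmod (f (t + \<sigma>) - f t) + cmod (f t) * cmod (character l (t + \<sigma>) - character l t)"
        by (rule order_trans[OF norm_triangle_ineq]) (simp add: norm_mult)
      also have "\<dots> < \<epsilon> / 2 + B * \<delta>"
        using B 2 by (intro add_less_le_mono 1 mult_mono) auto
      also have "\<dots> = \<epsilon>" using B(1) by (simp add: \<delta>_def)
      finally show ?thesis .
    qed
    ultimately show ?thesis by blast
  qed
  moreover have "L + 2 * M > 0" using L(1) M(1) by simp
  ultimately show "relatively_dense (translation_set (\<lambda>t. f t * character l t) \<epsilon>)"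
    unfolding relatively_dense_def translation_set_def
    by (intro exI[of _ "L + 2 * M"]) blast
qed

text \<open>
  If \<open>s\<close> is itself a translation number, the integrals over \<open>[s, s + T]\<close> and \<open>[0, T]\<close> differ by at most
  \<open>\<epsilon> T\<close>. In general, moving the window from \<open>s\<close> to a translation number within distance \<open>L\<close> costs a
  contribution at each end, independent of \<open>T\<close>.
\<close>
lemma AP_integral_translate:
  assumes f: "f \<in> AP" and \<epsilon>: "\<epsilon> > 0"
  obtains C where "C > 0"
    "\<And>s T. T \<ge> 0 \<Longrightarrow> cmod (integral {s..s + T} f - integral {0..T} f) \<le> \<epsilon> * T + C"
proof -
  obtain B where B: "B > 0" "\<And>t. cmod (f t) \<le> B" using AP_bounded[OF f] by blast
  obtain L where L: "L > 0" "\<And>s. \<exists>\<tau>\<in>{s..s + L}. \<forall>t. cmod (f (t + \<tau>) - f t) < \<epsilon>"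
    using AP_translation_number[OF f \<epsilon>] by blast
  have int: "f integrable_on {p..q}" for p q
    by (intro integrable_continuous_real AP_continuous f)
  have "cmod (integral {s..s + T} f - integral {0..T} f) \<le> \<epsilon> * T + 2 * B * L" if T: "T \<ge> 0" for s T
  proof -
    obtain \<tau> where \<tau>: "\<tau> \<in> {s..s + L}" "\<And>t. cmod (f (t + \<tau>) - f t) < \<epsilon>"
      using L(2) by blast
    have cont: "continuous_on S (\<lambda>t. f (t + \<tau>))" for S
      by (intro continuous_on_compose2[OF AP_continuous[OF f, of UNIV]] continuous_intros) auto
    have "integral {\<tau>..\<tau> + T} f - integral {0..T} f = integral {0..T} (\<lambda>t. f (t + \<tau>) - f t)"
      using integral_shift_real_ivl[of \<tau> \<tau> "\<tau> + T" f]
      by (simp add: integral_diff int integrable_continuous_real cont)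
    also have "cmod \<dots> \<le> \<epsilon> * (T - 0)"
      using \<tau>(2) T by (intro integral_bound continuous_intros cont AP_continuous f) (auto intro: less_imp_le)
    finally have 1: "cmod (integral {\<tau>..\<tau> + T} f - integral {0..T} f) \<le> \<epsilon> * T" by simp
    have "integral {s..\<tau>} f + integral {\<tau>..\<tau> + T} f = integral {s..\<tau> + T} f"
      using \<tau>(1) T by (intro Henstock_Kurzweil_Integration.integral_combine int) auto
    moreover have "integral {s..s + T} f + integral {s + T..\<tau> + T} f = integral {s..\<tau> + T} f"
      using \<tau>(1) T by (intro Henstock_Kurzweil_Integration.integral_combine int) auto
    ultimately have "integral {s..s + T} f - integral {\<tau>..\<tau> + T} f
        = integral {s..\<tau>} f - integral {s + T..\<tau> + T} f"
      by (simp add: algebra_simps)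
    also have "cmod \<dots> \<le> cmod (integral {s..\<tau>} f) + cmod (integral {s + T..\<tau> + T} f)"
      by (rule norm_triangle_ineq4)
    also have "\<dots> \<le> B * (\<tau> - s) + B * (\<tau> + T - (s + T))"
      using \<tau>(1) by (intro add_mono integral_bound AP_continuous f B(2)) auto
    also have "\<dots> \<le> B * L + B * L"
      using \<tau>(1) B(1) by (intro add_mono mult_left_mono) auto
    finally have 2: "cmod (integral {s..s + T} f - integral {\<tau>..\<tau> + T} f) \<le> 2 * B * L" by simp
    show ?thesis
      using norm_triangle_ineq[of "integral {s..s + T} f - integral {\<tau>..\<tau> + T} f"
        "integral {\<tau>..\<tau> + T} f - integral {0..T} f"] 1 2 by simp
  qed
  thus ?thesis using that[of "2 * B * L"] B(1) L(1) by simp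
qed

lemma AP_integral_multiple:
  assumes f: "f \<in> AP" and T: "T \<ge> 0"
    and C: "\<And>s. cmod (integral {s..s + T} f - integral {0..T} f) \<le> C"
  shows "cmod (integral {0..real n * T} f - of_nat n * integral {0..T} f) \<le> real n * C"
proof (induction n)
  case (Suc n)
  have "integral {0..real n * T} f + integral {real n * T..real n * T + T} f
      = integral {0..real n * T + T} f"
    using T by (intro Henstock_Kurzweil_Integration.integral_combine integrable_continuous_real AP_continuous f) auto
  hence "integral {0..real (Suc n) * T} f - of_nat (Suc n) * integral {0..T} f
     = (integral {0..real n * T} f - of_nat n * integral {0..T} f) +
       (integral {real n * T..real n * T + T} f - integral {0..T} f)"
    by (simp add: algebra_simps)
  also have "cmod \<dots> \<le> real n * C + C"
    by (intro norm_triangle_mono Suc.IH C)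
  finally show ?case by (simp add: algebra_simps)
qed simp

text \<open>
  Up to an error \<open>\<eta> T + C\<close> the integral over a window of length \<open>T\<close> does not depend on its position. A
  long window is a union of windows of a fixed length \<open>T\<close> and a short remainder, so its mean is close
  to the mean over \<open>[0, T]\<close>. Choosing \<open>T = C / \<eta>\<close> makes the error per window \<open>2 \<eta> T\<close>, that is,
  \<open>2 \<eta>\<close> for the mean; the remainder disappears as the long window grows.
\<close>
lemma AP_mean_almost_constant:
  assumes f: "f \<in> AP" and \<epsilon>: "\<epsilon> > 0"
  shows "\<exists>m. \<forall>\<^sub>F U in at_top. cmod (of_real (1 / (2 * U)) * integral {-U..U} f - m) \<le> \<epsilon>"
proof -
  obtain B where B: "B > 0" "\<And>t. cmod (f t) \<le> B" using AP_bounded[OF f] by blast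
  define \<eta> where "\<eta> = \<epsilon> / 5"
  have \<eta>: "\<eta> > 0" using \<epsilon> by (simp add: \<eta>_def)
  obtain C where C: "C > 0"
    "\<And>s T. T \<ge> 0 \<Longrightarrow> cmod (integral {s..s + T} f - integral {0..T} f) \<le> \<eta> * T + C"
    using AP_integral_translate[OF f \<eta>] by blast
  define I where "I = (\<lambda>V. integral {0..V} f)"
  define T where "T = C / \<eta>"
  have T: "T > 0" "C = \<eta> * T" using C(1) \<eta> by (simp_all add: T_def)
  have I_le: "cmod (I T) \<le> B * T"
    unfolding I_def using T integral_bound[of 0 T f B] by (simp add: AP_continuous f B(2))
  have long: "cmod (I V - of_real (V / T) * I T) \<le> 2 * B * T + 2 * \<eta> * V" if V: "V > 0" for V
  proof -
    define n where "n = nat \<lfloor>V / T\<rfloor>"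
    have "V / T \<ge> 0" using V T by simp
    hence n: "real n \<le> V / T" "V / T < real n + 1"
      unfolding n_def by linarith+
    hence n': "real n * T \<le> V" "V \<le> real n * T + T" using T by (simp_all add: field_simps)
    have "integral {0..real n * T} f + integral {real n * T..V} f = I V"
      unfolding I_def
      using T n' by (intro Henstock_Kurzweil_Integration.integral_combine integrable_continuous_real AP_continuous f) auto
    hence "I V - of_real (V / T) * I T = integral {real n * T..V} f +
        (integral {0..real n * T} f - of_nat n * I T) - of_real (V / T - real n) * I T"
      by (simp add: algebra_simps)
    also have "cmod \<dots> \<le> cmod (integral {real n * T..V} f) +
        cmod (integral {0..real n * T} f - of_nat n * I T) + cmod (of_real (V / T - real n) * I T)"
      by (intro order_trans[OF norm_triangle_ineq4] add_right_mono norm_triangle_ineq)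
    also have "\<dots> \<le> B * T + real n * (2 * (\<eta> * T)) + 1 * (B * T)"
    proof (intro add_mono)
      have "cmod (integral {real n * T..V} f) \<le> B * (V - real n * T)"
        using n' by (intro integral_bound AP_continuous f B(2))
      also have "\<dots> \<le> B * T" using n' B(1) by (intro mult_left_mono) auto
      finally show "cmod (integral {real n * T..V} f) \<le> B * T" .
      show "cmod (integral {0..real n * T} f - of_nat n * I T) \<le> real n * (2 * (\<eta> * T))"
        unfolding I_def using T C(2)[of T] by (intro AP_integral_multiple f) (auto simp: mult.commute)
      show "cmod (of_real (V / T - real n) * I T) \<le> 1 * (B * T)"
        unfolding norm_mult norm_of_real using n I_le by (intro mult_mono) auto
    qed
    also have "\<dots> = 2 * B * T + 2 * \<eta> * (real n * T)" by (simp add: algebra_simps)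
    also have "\<dots> \<le> 2 * B * T + 2 * \<eta> * V" using n' \<eta> by simp
    finally show ?thesis .
  qed
  \<comment> \<open>From here on the terms that do not grow with \<open>U\<close> are at most \<open>\<eta> U\<close>.\<close>
  define U0 where "U0 = (2 * B * T + C) / \<eta>"
  have U0: "U0 > 0" using B(1) T(1) C(1) \<eta> by (auto simp: U0_def intro!: divide_pos_pos add_pos_pos)
  have "cmod (of_real (1 / (2 * U)) * integral {-U..U} f - I T / of_real T) \<le> \<epsilon>"
    if U: "U \<ge> U0" for U
  proof -
    have "U > 0" using U U0 by linarith
    have "2 * B * T + C \<le> \<eta> * U" using U \<eta> by (simp add: U0_def field_simps)
    \<comment> \<open>The symmetric window is the window \<open>[0, 2U]\<close> translated by \<open>-U\<close>.\<close>
    have "cmod (integral {-U..U} f - I (2 * U)) \<le> \<eta> * (2 * U) + C"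
      using C(2)[of "2 * U" "- U"] \<open>U > 0\<close> by (simp add: I_def)
    moreover have "cmod (I (2 * U) - of_real (2 * U / T) * I T) \<le> 2 * B * T + 2 * \<eta> * (2 * U)"
      using \<open>U > 0\<close> by (intro long) auto
    ultimately have "cmod ((integral {-U..U} f - I (2 * U)) + (I (2 * U) - of_real (2 * U / T) * I T))
        \<le> (\<eta> * (2 * U) + C) + (2 * B * T + 2 * \<eta> * (2 * U))"
      by (intro norm_triangle_mono)
    also have "\<dots> \<le> 7 * \<eta> * U" using \<open>2 * B * T + C \<le> \<eta> * U\<close> by linarith
    finally have *: "cmod (integral {-U..U} f - of_real (2 * U / T) * I T) \<le> 7 * \<eta> * U" by simp
    have "of_real (1 / (2 * U)) * integral {-U..U} f - I T / of_real T
       = of_real (1 / (2 * U)) * (integral {-U..U} f - of_real (2 * U / T) * I T)"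
      using \<open>U > 0\<close> T by (simp add: field_simps)
    also have "cmod \<dots> \<le> 1 / (2 * U) * (7 * \<eta> * U)"
      unfolding norm_mult norm_of_real using \<open>U > 0\<close> * by (intro mult_mono) auto
    also have "\<dots> \<le> \<epsilon>" using \<open>U > 0\<close> \<epsilon> by (simp add: \<eta>_def)
    finally show ?thesis .
  qed
  thus ?thesis by (auto simp: eventually_at_top_linorder)
qed

text \<open>A Cauchy criterion at infinity: the limit is found along the integers.\<close>
lemma tendsto_at_top_if_almost_constant:
  fixes h :: "real \<Rightarrow> 'a :: banach"
  assumes "\<And>\<epsilon>. \<epsilon> > 0 \<Longrightarrow> \<exists>m. \<forall>\<^sub>F U in at_top. norm (h U - m) \<le> \<epsilon>"
  shows "\<exists>c. (h \<longlongrightarrow> c) at_top"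
proof -
  have "Cauchy (\<lambda>n. h (real n))"
  proof (rule CauchyI)
    fix e :: real assume "e > 0"
    then obtain m where "\<forall>\<^sub>F U in at_top. norm (h U - m) \<le> e / 3" using assms[of "e / 3"] by auto
    then obtain N where N: "\<And>U. U \<ge> N \<Longrightarrow> norm (h U - m) \<le> e / 3"
      by (auto simp: eventually_at_top_linorder)
    have "norm (h (real j) - h (real k)) < e" if "j \<ge> nat \<lceil>N\<rceil>" "k \<ge> nat \<lceil>N\<rceil>" for j k
      using norm_triangle_ineq4[of "h (real j) - m" "h (real k) - m"] N[of "real j"] N[of "real k"] that \<open>e > 0\<close>
      by simp
    thus "\<exists>M. \<forall>j\<ge>M. \<forall>k\<ge>M. norm (h (real j) - h (real k)) < e" by blast
  qed
  then obtain c where c: "(\<lambda>n. h (real n)) \<longlonglongrightarrow> c" by (auto simp: Cauchy_convergent_iff convergent_def)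
  have "(h \<longlongrightarrow> c) at_top"
  proof (rule tendstoI)
    fix e :: real assume "e > 0"
    then obtain m where m: "\<forall>\<^sub>F U in at_top. norm (h U - m) \<le> e / 3" using assms[of "e / 3"] by auto
    have near: "norm (c - m) \<le> e / 3"
    proof (rule tendsto_upperbound)
      show "(\<lambda>n. norm (h (real n) - m)) \<longlonglongrightarrow> norm (c - m)" by (intro tendsto_intros c)
      show "\<forall>\<^sub>F n in sequentially. norm (h (real n) - m) \<le> e / 3"
        by (rule eventually_compose_filterlim[OF m filterlim_real_sequentially])
    qed simp
    from m show "\<forall>\<^sub>F U in at_top. dist (h U) c < e"
    proof eventually_elim
      case (elim U)
      thus ?case using norm_triangle_ineq4[of "h U - m" "c - m"] near \<open>e > 0\<close> by (simp add: dist_norm)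
    qed
  qed
  thus ?thesis by blast
qed

definition fourier_bohr :: "(real \<Rightarrow> complex) \<Rightarrow> real \<Rightarrow> complex" where
  "fourier_bohr f l = Lim at_top
     (\<lambda>T. of_real (1 / (2 * T)) * integral {-T..T} (\<lambda>t. f t * character l t))"

lemma fourier_bohr_tendsto:
  assumes "f \<in> AP"
  shows "((\<lambda>T. of_real (1 / (2 * T)) * integral {-T..T} (\<lambda>t. f t * character l t))
           \<longlongrightarrow> fourier_bohr f l) at_top"
proof -
  have "\<exists>c. ((\<lambda>T. of_real (1 / (2 * T)) * integral {-T..T} (\<lambda>t. f t * character l t)) \<longlongrightarrow> c) at_top"
    by (intro tendsto_at_top_if_almost_constant AP_mean_almost_constant AP_mult_character assms)
  thus ?thesis unfolding fourier_bohr_def by (auto simp: tendsto_Lim)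
qed

text \<open>
  Since all coefficients exist, a real number fails to be a frequency only because its coefficient
  vanishes, never because the mean diverges.
\<close>
lemma Freq_AP:
  assumes "f \<in> AP"
  shows "Freq f = {l. fourier_bohr f l \<noteq> 0}"
proof -
  have "Freq f = {l. \<exists>c. c \<noteq> 0 \<and>
      ((\<lambda>T. of_real (1 / (2 * T)) * integral {-T..T} (\<lambda>t. f t * character l t)) \<longlongrightarrow> c) at_top}"
    unfolding Freq_def character_def ..
  also have "\<dots> = {l. fourier_bohr f l \<noteq> 0}"
    using fourier_bohr_tendsto[OF assms] tendsto_unique[OF trivial_limit_at_top_linorder] by blast
  finally show ?thesis .
qed

section \<open>The equation with reflection\<close>

text \<open>
  The even and odd parts of the right-hand side are solved for separately. Besides the solution, the
  lemma provides a bound for the derivative and one constant \<open>C\<close> that controls all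
  translation differences of \<open>x\<close> by those of \<open>g\<close>. The full equation is not translation invariant, but its two
  scalar components are, and a translation number \<open>\<tau>\<close> of \<open>g\<close> is also one of \<open>t \<mapsto> g(-t)\<close>, hence of both parts.
\<close>
lemma reflection_bounded_solution_exists:
  assumes ab: "a < b" "b < - a" and cont: "continuous_on UNIV g" and gb: "\<And>t. cmod (g t) \<le> B"
  obtains x x' x'' M K C where
    "\<And>t. (x has_vector_derivative x' t) (at t)"
    "\<And>t. (x' has_vector_derivative x'' t) (at t)"
    "\<And>t. x'' t + of_real a * x t + of_real b * x (- t) = g t"
    "\<And>t. cmod (x t) \<le> M" "\<And>t. cmod (x' t) \<le> K" "C > 0"
    "\<forall>\<tau> e. (\<forall>t. cmod (g (t + \<tau>) - g t) \<le> e) \<longrightarrow> (\<forall>t. cmod (x (t + \<tau>) - x t) \<le> C * e)"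
proof -
  define \<alpha> \<beta> where "\<alpha> = sqrt (- (a + b))" and "\<beta> = sqrt (b - a)"
  have \<alpha>: "\<alpha> > 0" "\<alpha>\<^sup>2 = - (a + b)" and \<beta>: "\<beta> > 0" "\<beta>\<^sup>2 = b - a"
    using ab by (simp_all add: \<alpha>_def \<beta>_def)
  define ge go where "ge = (\<lambda>t. (g t + g (- t)) / 2)" and "go = (\<lambda>t. (g t - g (- t)) / 2)"
  have contm: "continuous_on UNIV (\<lambda>t. g (- t))"
    by (intro continuous_on_compose2[OF cont] continuous_intros) auto
  have conte: "continuous_on UNIV ge" and conto: "continuous_on UNIV go"
    unfolding ge_def go_def by (intro continuous_intros cont contm; simp)+
  have half_add: "cmod ((u + v) / 2) \<le> e" and half_diff: "cmod ((u - v) / 2) \<le> e"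
    if "cmod u \<le> e" "cmod v \<le> e" for u v e
    using norm_triangle_ineq[of u v] norm_triangle_ineq4[of u v] that by (auto simp: norm_divide)
  have geb: "cmod (ge t) \<le> B" and gob: "cmod (go t) \<le> B" for t
    unfolding ge_def go_def by (intro half_add half_diff gb)+
  obtain p p' where p1: "\<And>t. (p has_vector_derivative p' t) (at t)"
    and p2: "\<And>t. (p' has_vector_derivative (of_real (\<alpha>\<^sup>2) * p t + ge t)) (at t)"
    and pb: "\<And>t. cmod (p t) \<le> B / \<alpha>\<^sup>2" "\<And>t. cmod (p' t) \<le> B / \<alpha>"
    by (rule bounded_solution_exists[OF conte geb \<alpha>(1)], rule that)
  obtain q q' where q1: "\<And>t. (q has_vector_derivative q' t) (at t)"
    and q2: "\<And>t. (q' has_vector_derivative (of_real (\<beta>\<^sup>2) * q t + go t)) (at t)"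
    and qb: "\<And>t. cmod (q t) \<le> B / \<beta>\<^sup>2" "\<And>t. cmod (q' t) \<le> B / \<beta>"
    by (rule bounded_solution_exists[OF conto gob \<beta>(1)], rule that)
  have even: "p (- t) = p t" for t
    using bounded_solution_parity[OF \<alpha>(1) p1 p2 pb(1), of 1 t] by (simp add: ge_def add.commute)
  have odd: "q (- t) = - q t" for t
    using bounded_solution_parity[OF \<beta>(1) q1 q2 qb(1), of "- 1" t] by (simp add: go_def field_simps)
  show ?thesis
  proof (rule that[of "\<lambda>t. p t + q t" "\<lambda>t. p' t + q' t"
        "\<lambda>t. (of_real (\<alpha>\<^sup>2) * p t + ge t) + (of_real (\<beta>\<^sup>2) * q t + go t)"
        "B / \<alpha>\<^sup>2 + B / \<beta>\<^sup>2" "B / \<alpha> + B / \<beta>" "1 / \<alpha>\<^sup>2 + 1 / \<beta>\<^sup>2"])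
    show "((\<lambda>t. p t + q t) has_vector_derivative p' t + q' t) (at t)" for t
      by (intro derivative_intros p1 q1)
    show "((\<lambda>t. p' t + q' t) has_vector_derivative
        (of_real (\<alpha>\<^sup>2) * p t + ge t) + (of_real (\<beta>\<^sup>2) * q t + go t)) (at t)" for t
      by (intro has_vector_derivative_add p2 q2)
    show "(of_real (\<alpha>\<^sup>2) * p t + ge t) + (of_real (\<beta>\<^sup>2) * q t + go t) + of_real a * (p t + q t) +
        of_real b * (p (- t) + q (- t)) = g t" for t
      unfolding \<alpha>(2) \<beta>(2) even odd ge_def go_def by (simp add: field_simps)
    show "cmod (p t + q t) \<le> B / \<alpha>\<^sup>2 + B / \<beta>\<^sup>2" "cmod (p' t + q' t) \<le> B / \<alpha> + B / \<beta>" for t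
      by (intro norm_triangle_mono pb qb)+
    show "1 / \<alpha>\<^sup>2 + 1 / \<beta>\<^sup>2 > 0" using \<alpha>(1) \<beta>(1) by (intro add_pos_pos) auto
    show "\<forall>\<tau> e. (\<forall>t. cmod (g (t + \<tau>) - g t) \<le> e) \<longrightarrow>
      (\<forall>t. cmod (p (t + \<tau>) + q (t + \<tau>) - (p t + q t)) \<le> (1 / \<alpha>\<^sup>2 + 1 / \<beta>\<^sup>2) * e)"
    proof (intro allI impI)
      fix \<tau> e t assume "\<forall>t. cmod (g (t + \<tau>) - g t) \<le> e"
      hence e: "cmod (g (t + \<tau>) - g t) \<le> e" for t by blast
      have e': "cmod (g (- (t + \<tau>)) - g (- t)) \<le> e" for t
        using e[of "- t - \<tau>"] by (simp add: norm_minus_commute)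
      have "cmod (ge (t + \<tau>) - ge t) \<le> e" for t
      proof -
        have "ge (t + \<tau>) - ge t = ((g (t + \<tau>) - g t) + (g (- (t + \<tau>)) - g (- t))) / 2"
          by (simp add: ge_def field_simps)
        thus ?thesis using half_add[OF e e', of t t] by (simp only:)
      qed
      hence "cmod (p (t + \<tau>) - p t) \<le> e / \<alpha>\<^sup>2"
        by (rule bounded_solution_translate[OF \<alpha>(1) conte p1 p2 pb(1)])
      moreover have "cmod (go (t + \<tau>) - go t) \<le> e" for t
      proof -
        have "go (t + \<tau>) - go t = ((g (t + \<tau>) - g t) - (g (- (t + \<tau>)) - g (- t))) / 2"
          by (simp add: go_def field_simps)
        thus ?thesis using half_diff[OF e e', of t t] by (simp only:)
      qed
      hence "cmod (q (t + \<tau>) - q t) \<le> e / \<beta>\<^sup>2"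
        by (rule bounded_solution_translate[OF \<beta>(1) conto q1 q2 qb(1)])
      ultimately have "cmod ((p (t + \<tau>) - p t) + (q (t + \<tau>) - q t)) \<le> e / \<alpha>\<^sup>2 + e / \<beta>\<^sup>2"
        by (rule norm_triangle_mono)
      thus "cmod (p (t + \<tau>) + q (t + \<tau>) - (p t + q t)) \<le> (1 / \<alpha>\<^sup>2 + 1 / \<beta>\<^sup>2) * e"
        by (simp add: algebra_simps)
    qed
  qed
qed

text \<open>
  For a difference \<open>d\<close> of two solutions and \<open>s = \<plusminus>1\<close>, the combination \<open>d(t) + s d(-t)\<close> is a bounded solution of
  a homogeneous scalar equation with coefficient \<open>-(a + s b) > 0\<close>.
\<close>
lemma reflection_bounded_solution_unique:
  assumes ab: "a < b" "b < - a"
    and x: "reflection_solution a b g x" and xb: "\<And>t. cmod (x t) \<le> M"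
    and z: "reflection_solution a b g z" and zb: "\<And>t. cmod (z t) \<le> N"
  shows "x = z"
proof
  fix t
  obtain x' x'' where x1: "\<And>t. (x has_vector_derivative x' t) (at t)"
    and x2: "\<And>t. (x' has_vector_derivative x'' t) (at t)"
    and xeq: "\<And>t. x'' t + of_real a * x t + of_real b * x (- t) = g t"
    using x unfolding reflection_solution_def by blast
  obtain z' z'' where z1: "\<And>t. (z has_vector_derivative z' t) (at t)"
    and z2: "\<And>t. (z' has_vector_derivative z'' t) (at t)"
    and zeq: "\<And>t. z'' t + of_real a * z t + of_real b * z (- t) = g t"
    using z unfolding reflection_solution_def by blast
  define d d' where "d = (\<lambda>t. x t - z t)" and "d' = (\<lambda>t. x' t - z' t)"
  have d1: "(d has_vector_derivative d' t) (at t)" for t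
    unfolding d_def d'_def by (intro derivative_intros x1 z1)
  have d2: "(d' has_vector_derivative (- (of_real a * d t + of_real b * d (- t)))) (at t)" for t
  proof -
    have "x'' t - z'' t = - (of_real a * d t + of_real b * d (- t))"
    proof -
      have "x'' t - z'' t = g t - (of_real a * x t + of_real b * x (- t)) -
          (g t - (of_real a * z t + of_real b * z (- t)))"
        by (subst xeq[of t, symmetric], subst zeq[of t, symmetric]) (simp add: algebra_simps)
      thus ?thesis by (simp add: d_def algebra_simps)
    qed
    thus ?thesis using has_vector_derivative_diff[OF x2 z2, of t] by (simp add: d'_def)
  qed
  have db: "cmod (d t) \<le> M + N" for t
    using norm_triangle_ineq4[of "x t" "z t"] xb[of t] zb[of t] by (simp add: d_def)
  have mode: "d t + s * d (- t) = 0" if s: "s * s = 1" and neg: "of_real k = of_real a + s * of_real b" "k < 0"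
    for s :: complex and k
  proof -
    \<comment> \<open>Here \<open>k = a + s b\<close>, so the rate \<open>c\<close> of the scalar equation is \<open>sqrt (-k)\<close>.\<close>
    show ?thesis
    proof (rule bounded_solution_unique[where y = "\<lambda>t. d t + s * d (- t)" and t = t])
      show "sqrt (- k) > 0" using neg by simp
      show "((\<lambda>t. d t + s * d (- t)) has_vector_derivative d' t + s * (- d' (- t))) (at t)" for t
        by (intro derivative_intros has_vector_derivative_compose_uminus d1)
      have "of_real ((sqrt (- k))\<^sup>2) * (d t + s * d (- t)) =
          - (of_real a * d t + of_real b * d (- t)) + s * - (of_real a * d (- t) + of_real b * d t)
          - of_real b * d (- t) * (s * s - 1)" for t
        using neg by (simp add: algebra_simps)
      hence mode_eq: "of_real ((sqrt (- k))\<^sup>2) * (d t + s * d (- t)) =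
          - (of_real a * d t + of_real b * d (- t)) + s * - (of_real a * d (- t) + of_real b * d t)" for t
        by (simp only: s diff_self mult_zero_right diff_zero)
      show "((\<lambda>t. d' t + s * (- d' (- t))) has_vector_derivative
          of_real ((sqrt (- k))\<^sup>2) * (d t + s * d (- t))) (at t)" for t
        unfolding mode_eq
        by (rule derivative_eq_intros has_vector_derivative_compose_uminus d2 refl)+
           (simp add: algebra_simps)
      show "cmod (d t + s * d (- t)) \<le> (M + N) + cmod s * (M + N)" for t
        unfolding norm_mult[symmetric]
        by (intro norm_triangle_mono db) (simp add: norm_mult mult_left_mono db)
    qed
  qed
  have "d t + d (- t) = 0" "d t - d (- t) = 0"
    using mode[of 1 "a + b"] mode[of "- 1" "a - b"] ab by simp_all
  thus "x t = z t" by (simp add: d_def add_eq_0_iff)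
qed

lemma reflection_solution_continuous:
  "reflection_solution a b g x \<Longrightarrow> continuous_on S x"
  unfolding reflection_solution_def
  by (metis continuous_at_imp_continuous_on has_vector_derivative_continuous)

lemma continuous_periodic_bounded:
  fixes f :: "real \<Rightarrow> complex"
  assumes "\<omega> > 0" and "periodic_fun_simple f \<omega>" and cont: "continuous_on UNIV f"
  obtains B where "\<And>t. cmod (f t) \<le> B"
proof -
  interpret periodic_fun_simple f \<omega> by fact
  have "bounded (f ` {0..\<omega>})"
    by (intro compact_imp_bounded compact_continuous_image continuous_on_subset[OF cont]) auto
  then obtain B where B: "\<And>t. t \<in> {0..\<omega>} \<Longrightarrow> cmod (f t) \<le> B"
    unfolding bounded_iff by blast
  have "cmod (f t) \<le> B" for t
  proof -
    define n where "n = \<lfloor>t / \<omega>\<rfloor>"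
    have "of_int n \<le> t / \<omega>" "t / \<omega> < of_int n + 1" unfolding n_def by linarith+
    hence "t - of_int n * \<omega> \<in> {0..\<omega>}" using \<open>\<omega> > 0\<close> by (simp add: field_simps)
    thus ?thesis using B[of "t - of_int n * \<omega>"] minus_of_int[of t n] by simp
  qed
  thus ?thesis using that by blast
qed

section \<open>Frequency modules\<close>

text \<open>
  The derivative of \<open>(x' + i\<lambda>x) e\<^bsup>-i\<lambda>t\<^esup>\<close> is \<open>(x'' + \<lambda>\<^sup>2x) e\<^bsup>-i\<lambda>t\<^esup>\<close>, which packs both integrations by parts into one.
  The boundary terms are bounded because \<open>x\<close> and \<open>x'\<close> are, and vanish in the mean.
  Reflection exchanges the coefficients at \<open>\<lambda>\<close> and \<open>-\<lambda>\<close>.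
\<close>
lemma fourier_bohr_reflection_equation:
  assumes x: "x \<in> AP" and g: "g \<in> AP"
    and d1: "\<And>t. (x has_vector_derivative x' t) (at t)"
    and d2: "\<And>t. (x' has_vector_derivative x'' t) (at t)"
    and eq: "\<And>t. x'' t + of_real a * x t + of_real b * x (- t) = g t"
    and bd: "\<And>t. cmod (x' t) \<le> K"
  shows "fourier_bohr g l = of_real (a - l\<^sup>2) * fourier_bohr x l + of_real b * fourier_bohr x (- l)"
proof -
  obtain B where B: "\<And>t. cmod (x t) \<le> B" using AP_bounded[OF x] by blast
  define H where "H = (\<lambda>t. (x' t + \<i> * of_real l * x t) * character l t)"
  define A where "A = (\<lambda>f l T. complex_of_real (1 / (2 * T)) * integral {-T..T} (\<lambda>t. f t * character l t))"
  have Hb: "cmod (H t) \<le> K + \<bar>l\<bar> * B" for t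
  proof -
    have "cmod (\<i> * of_real l * x t) \<le> \<bar>l\<bar> * B"
      using B[of t] by (simp add: norm_mult mult_left_mono)
    from norm_triangle_mono[OF bd this] show ?thesis by (simp add: H_def norm_mult)
  qed
  have dchar: "(character l has_vector_derivative - (\<i> * of_real l) * character l t) (at t)" for t
  proof -
    have "((\<lambda>t. exp (t *\<^sub>R (- (\<i> * of_real l)))) has_vector_derivative
        exp (t *\<^sub>R (- (\<i> * of_real l))) * (- (\<i> * of_real l))) (at t)"
      by (rule exp_scaleR_has_vector_derivative_right)
    moreover have "(\<lambda>t. exp (t *\<^sub>R (- (\<i> * of_real l)))) = character l"
      by (auto simp: character_def scaleR_conv_of_real mult_ac)
    ultimately show ?thesis by (simp add: mult.commute fun_eq_iff)
  qed
  have int: "(\<lambda>t. f t * character m t) integrable_on {p..q}" if "f \<in> AP" for f m p q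
    by (intro integrable_continuous_real continuous_intros AP_continuous that)
  have refl: "integral {-T..T} (\<lambda>t. x (- t) * character l t)
      = integral {-T..T} (\<lambda>t. x t * character (- l) t)" for T
    using Henstock_Kurzweil_Integration.integral_reflect_real[of "T" "- T" "\<lambda>t. x t * character (- l) t"]
    by (simp add: character_uminus)
  have int': "(\<lambda>t. x (- t) * character l t) integrable_on {p..q}" for p q
    by (intro integrable_continuous_real continuous_intros
         continuous_on_compose2[OF AP_continuous[OF x, of UNIV]]) auto
  have "A g l T - (of_real (a - l\<^sup>2) * A x l T + of_real b * A x (- l) T)
      = of_real (1 / (2 * T)) * (H T - H (- T))" if T: "T > 0" for T
  proof -
    have "((\<lambda>t. g t * character l t - (of_real (a - l\<^sup>2) * (x t * character l t)
           + of_real b * (x (- t) * character l t))) has_integral (H T - H (- T))) {-T..T}"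
    proof (rule fundamental_theorem_of_calculus)
      fix t
      have "(H has_vector_derivative g t * character l t - (of_real (a - l\<^sup>2) * (x t * character l t)
           + of_real b * (x (- t) * character l t))) (at t)"
        unfolding H_def eq[symmetric]
        using has_vector_derivative_mult[OF has_vector_derivative_add[OF d2
          has_vector_derivative_mult_right[OF d1]] dchar, of "\<i> * of_real l" t]
        by (simp add: algebra_simps power2_eq_square)
      thus "(H has_vector_derivative g t * character l t - (of_real (a - l\<^sup>2) * (x t * character l t)
           + of_real b * (x (- t) * character l t))) (at t within {-T..T})"
        by (rule has_vector_derivative_at_within)
    qed (use T in auto)
    moreover have "((\<lambda>t. g t * character l t - (of_real (a - l\<^sup>2) * (x t * character l t)
           + of_real b * (x (- t) * character l t))) has_integral
        integral {-T..T} (\<lambda>t. g t * character l t) -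
        (of_real (a - l\<^sup>2) * integral {-T..T} (\<lambda>t. x t * character l t)
          + of_real b * integral {-T..T} (\<lambda>t. x (- t) * character l t))) {-T..T}"
      by (intro has_integral_diff has_integral_add has_integral_mult_right integrable_integral int int' x g)
    ultimately have HT: "H T - H (- T) = integral {-T..T} (\<lambda>t. g t * character l t) -
        (of_real (a - l\<^sup>2) * integral {-T..T} (\<lambda>t. x t * character l t)
          + of_real b * integral {-T..T} (\<lambda>t. x (- t) * character l t))"
      by (rule has_integral_unique)
    show ?thesis
      unfolding A_def HT refl by (simp only: right_diff_distrib distrib_left mult.left_commute)
  qed
  hence *: "\<forall>\<^sub>F T in at_top. A g l T - (of_real (a - l\<^sup>2) * A x l T + of_real b * A x (- l) T)
      = of_real (1 / (2 * T)) * (H T - H (- T))"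
    using eventually_gt_at_top[of 0] by (rule eventually_mono[rotated])
  have "((\<lambda>T. of_real (1 / (2 * T)) * (H T - H (- T))) \<longlongrightarrow> 0) at_top"
  proof (rule Lim_null_comparison)
    show "\<forall>\<^sub>F T in at_top. cmod (of_real (1 / (2 * T)) * (H T - H (- T))) \<le> (K + \<bar>l\<bar> * B) / T"
      using eventually_gt_at_top[of 0]
    proof eventually_elim
      case (elim T)
      have "cmod (H T - H (- T)) \<le> 2 * (K + \<bar>l\<bar> * B)"
        using norm_triangle_ineq4[of "H T" "H (- T)"] add_mono[OF Hb[of T] Hb[of "- T"]]
        by (simp add: algebra_simps)
      thus ?case using elim by (simp add: norm_mult norm_divide field_simps)
    qed
    show "((\<lambda>T. (K + \<bar>l\<bar> * B) / T) \<longlongrightarrow> 0) at_top"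
      by (intro tendsto_divide_0[OF tendsto_const] filterlim_at_top_imp_at_infinity filterlim_ident)
  qed
  with * have "((\<lambda>T. A g l T - (of_real (a - l\<^sup>2) * A x l T + of_real b * A x (- l) T)) \<longlongrightarrow> 0) at_top"
    by (simp add: tendsto_cong)
  moreover have "((\<lambda>T. A g l T - (of_real (a - l\<^sup>2) * A x l T + of_real b * A x (- l) T)) \<longlongrightarrow>
      fourier_bohr g l - (of_real (a - l\<^sup>2) * fourier_bohr x l + of_real b * fourier_bohr x (- l))) at_top"
    unfolding A_def by (intro tendsto_intros fourier_bohr_tendsto x g)
  ultimately have "0 = fourier_bohr g l - (of_real (a - l\<^sup>2) * fourier_bohr x l + of_real b * fourier_bohr x (- l))"
    by (rule tendsto_unique[OF trivial_limit_at_top_linorder])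
  thus ?thesis by simp
qed

lemma group_closure_subset_if_symmetric:
  fixes S T :: "real set"
  assumes "\<And>s. s \<in> S \<Longrightarrow> s \<in> T \<or> - s \<in> T"
  shows "group_closure S \<subseteq> group_closure T"
proof
  fix s assume "s \<in> group_closure S"
  thus "s \<in> group_closure T"
  proof induction
    case (base s)
    then consider "s = 0" | "s \<in> T" | "- s \<in> T" using assms by blast
    thus ?case
    proof cases
      case 3
      hence "- s \<in> group_closure T" by (intro group_closure.base) simp
      thus ?thesis by simp
    qed (auto intro: group_closure.base)
  qed (rule group_closure.diff)
qed

text \<open>
  If the coefficients of \<open>x\<close> at \<open>\<plusminus>\<lambda>\<close> vanish, so do those of \<open>g\<close>. Conversely, adding and
  subtracting the two relations at \<open>\<lambda>\<close> and \<open>-\<lambda>\<close> decouples the sum and the difference of the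
  coefficients of \<open>x\<close>, with nonzero factors \<open>a - \<lambda>\<^sup>2 + b\<close> and \<open>a - \<lambda>\<^sup>2 - b\<close>.
\<close>
lemma freq_module_reflection_equation:
  assumes x: "x \<in> AP" and g: "g \<in> AP" and ab: "a < b" "b < - a"
    and d1: "\<And>t. (x has_vector_derivative x' t) (at t)"
    and d2: "\<And>t. (x' has_vector_derivative x'' t) (at t)"
    and eq: "\<And>t. x'' t + of_real a * x t + of_real b * x (- t) = g t"
    and bd: "\<And>t. cmod (x' t) \<le> K"
  shows "freq_module x = freq_module g"
proof -
  note coeff = fourier_bohr_reflection_equation[OF x g d1 d2 eq bd]
  have "group_closure (Freq g) \<subseteq> group_closure (Freq x)"
  proof (rule group_closure_subset_if_symmetric)
    fix l assume "l \<in> Freq g"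
    thus "l \<in> Freq x \<or> - l \<in> Freq x" using coeff[of l] by (auto simp: Freq_AP x g)
  qed
  moreover have "group_closure (Freq x) \<subseteq> group_closure (Freq g)"
  proof (rule group_closure_subset_if_symmetric)
    fix l assume l: "l \<in> Freq x"
    show "l \<in> Freq g \<or> - l \<in> Freq g"
    proof (rule ccontr)
      assume "\<not> (l \<in> Freq g \<or> - l \<in> Freq g)"
      define X Y where "X = fourier_bohr x l" and "Y = fourier_bohr x (- l)"
      have 1: "of_real (a - l\<^sup>2) * X + of_real b * Y = 0"
        and 2: "of_real (a - l\<^sup>2) * Y + of_real b * X = 0"
        using \<open>\<not> _\<close> coeff[of l] coeff[of "- l"] by (auto simp: Freq_AP x g X_def Y_def)
      have "of_real (a - l\<^sup>2 + b) * (X + Y) =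
            (of_real (a - l\<^sup>2) * X + of_real b * Y) + (of_real (a - l\<^sup>2) * Y + of_real b * X)"
        and "of_real (a - l\<^sup>2 - b) * (X - Y) =
            (of_real (a - l\<^sup>2) * X + of_real b * Y) - (of_real (a - l\<^sup>2) * Y + of_real b * X)"
        by (simp_all add: algebra_simps)
      hence "of_real (a - l\<^sup>2 + b) * (X + Y) = 0" "of_real (a - l\<^sup>2 - b) * (X - Y) = 0"
        unfolding 1 2 by simp_all
      moreover have "a - l\<^sup>2 + b < 0" "a - l\<^sup>2 - b < 0"
        using ab zero_le_power2[of l] by linarith+
      ultimately have "X + Y = 0" "X - Y = 0" by (metis less_irrefl mult_eq_0_iff of_real_eq_0_iff)+
      hence "X = 0" by (simp add: add_eq_0_iff)
      thus False using l by (simp add: Freq_AP x X_def)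
    qed
  qed
  ultimately show ?thesis unfolding freq_module_def by blast
qed

section \<open>Almost periodic and harmonic solutions\<close>

theorem theorem3p4:
  fixes a b :: real and g :: "real \<Rightarrow> complex"
  assumes "b \<noteq> 0" and "a < b" and "b < - a"
    and "g \<in> AP"
  shows "(\<exists>!x. x \<in> AP \<and> reflection_solution a b g x) \<and>
    (\<forall>x. x \<in> AP \<and> reflection_solution a b g x \<longrightarrow> freq_module x = freq_module g) \<and>
    (\<forall>\<omega>>0. periodic_fun_simple g \<omega> \<longrightarrow>
      (\<exists>!x. periodic_fun_simple x \<omega> \<and> reflection_solution a b g x))"
proof -
  note ab = \<open>a < b\<close> \<open>b < - a\<close>
  obtain B where gb: "\<And>t. cmod (g t) \<le> B" using AP_bounded[OF \<open>g \<in> AP\<close>] by blast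
  obtain x x' x'' M K C where
    x1: "\<And>t. (x has_vector_derivative x' t) (at t)"
    and x2: "\<And>t. (x' has_vector_derivative x'' t) (at t)"
    and xeq: "\<And>t. x'' t + of_real a * x t + of_real b * x (- t) = g t"
    and xb: "\<And>t. cmod (x t) \<le> M" and x'b: "\<And>t. cmod (x' t) \<le> K" and C: "C > 0"
    and trans: "\<forall>\<tau> e. (\<forall>t. cmod (g (t + \<tau>) - g t) \<le> e) \<longrightarrow> (\<forall>t. cmod (x (t + \<tau>) - x t) \<le> C * e)"
    by (rule reflection_bounded_solution_exists[OF ab AP_continuous[OF \<open>g \<in> AP\<close>] gb], rule that)
  have sol: "reflection_solution a b g x"
    unfolding reflection_solution_def using x1 x2 xeq by blast
  have unique: "z = x" if "reflection_solution a b g z" "\<And>t. cmod (z t) \<le> N" for z N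
    using reflection_bounded_solution_unique[OF ab that sol xb] .
  have "x \<in> AP"
    unfolding AP_def
  proof (intro CollectI conjI allI impI)
    show "continuous_on UNIV x" by (rule reflection_solution_continuous[OF sol])
    fix \<epsilon> :: real assume \<epsilon>: "\<epsilon> > 0"
    have "translation_set g (\<epsilon> / (2 * C)) \<subseteq> translation_set x \<epsilon>"
    proof
      fix \<tau> assume "\<tau> \<in> translation_set g (\<epsilon> / (2 * C))"
      hence "cmod (x (t + \<tau>) - x t) \<le> C * (\<epsilon> / (2 * C))" for t
        by (intro trans[rule_format]) (simp add: translation_set_def less_imp_le)
      moreover have "C * (\<epsilon> / (2 * C)) < \<epsilon>" using C \<epsilon> by simp
      ultimately show "\<tau> \<in> translation_set x \<epsilon>"
        unfolding translation_set_def by (blast intro: le_less_trans)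
    qed
    moreover have "relatively_dense (translation_set g (\<epsilon> / (2 * C)))"
      using \<open>g \<in> AP\<close> \<epsilon> C by (simp add: AP_def)
    ultimately show "relatively_dense (translation_set x \<epsilon>)"
      unfolding relatively_dense_def by blast
  qed
  have uniqueAP: "z = x" if "z \<in> AP" "reflection_solution a b g z" for z
  proof -
    obtain N where "\<And>t. cmod (z t) \<le> N" using AP_bounded[OF \<open>z \<in> AP\<close>] by blast
    thus ?thesis by (rule unique[OF \<open>reflection_solution a b g z\<close>])
  qed
  have "freq_module x = freq_module g"
    by (rule freq_module_reflection_equation[OF \<open>x \<in> AP\<close> \<open>g \<in> AP\<close> ab x1 x2 xeq x'b])
  moreover have "\<exists>!z. periodic_fun_simple z \<omega> \<and> reflection_solution a b g z"
    if \<omega>: "\<omega> > 0" and per: "periodic_fun_simple g \<omega>" for \<omega>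
  proof (rule ex1I[of _ x])
    interpret periodic_fun_simple g \<omega> by fact
    have "cmod (x (t + \<omega>) - x t) \<le> C * 0" for t
      by (intro trans[rule_format]) (simp add: plus_period)
    hence "periodic_fun_simple x \<omega>" by unfold_locales simp
    with sol show "periodic_fun_simple x \<omega> \<and> reflection_solution a b g x" by blast
    fix z assume z: "periodic_fun_simple z \<omega> \<and> reflection_solution a b g z"
    then obtain N where "\<And>t. cmod (z t) \<le> N"
      using continuous_periodic_bounded[OF \<omega> _ reflection_solution_continuous] by blast
    thus "z = x" using unique z by blast
  qed
  ultimately show ?thesis
    using \<open>x \<in> AP\<close> sol uniqueAP by (intro conjI ex1I[of _ x]) blast+
qed

end
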